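(* Let $\alpha$ be a finite set, $\tau$ an involution on $\alpha$, $S=\{(a,a,a)\mid a\in\alpha\}$ (that is, $S$ is diagonal), and $n$ a positive integer. Fukunaga's $T$ invariant of $n$-component nanophrases over $\alpha$, under the homotopy given by $(\alpha,\tau,S)$, is a degree $2$ finite type invariant.
   Context: Nanophrases and homotopy. An $n$-component Gauss phrase is a sequence of $n$ (possibly empty) finite words, written separated by the symbol $|$, such that every letter occurring in it occurs exactly twice in total. An $n$-component nanophrase over $\alpha$ is an $n$-component Gauss phrase $p$ together with a map $A\mapsto |A|$ from the set of letters appearing in $p$ to $\alpha$. Two nanophrases are isomorphic if a bijection of their letter sets preserving the map to $\alpha$ carries one Gauss phrase to the other letterwise. The homotopy given by $(\alpha,\tau,S)$ is the equivalence relation on $n$-component nanophrases generated by isomorphism and the moves (in both directions) H1: $xAAy\leftrightarrow xy$; H2: $xAByBAz\leftrightarrow xyz$ if $|A|=\tau(|B|)$; H3: $xAByACzBCt\leftrightarrow xBAyCAzCBt$ if $(|A|,|B|,|C|)\in S$; here $x,y,z,t$ are arbitrary sequences of letters, possibly including $|$, such that both sides are nanophrases, and all remaining letters keep their images in $\alpha$. An involution is a map $\tau$ with $\tau\circ\tau=\mathrm{id}$. Finite type invariants. $P(\alpha,\tau,S,n)$ is the set of homotopy classes of $n$-component nanophrases and $\mathbb{Z}P(\alpha,\tau,S,n)$ the free abelian group generated by it. A homotopy invariant is a function on $P(\alpha,\tau,S,n)$ with values in an additive abelian group, extended linearly to $\mathbb{Z}P(\alpha,\tau,S,n)$. A nanophrase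 in which a letter $A$ is marked as a semi-letter $\dot A$ denotes the formal sum $x\dot Ay\dot Az=xAyAz-xyz$; applied recursively, this defines nanophrases with any number of semi-letters as elements of $\mathbb{Z}P(\alpha,\tau,S,n)$. A homotopy invariant $v$ is a finite type invariant if there is an integer $m$ such that $v(p)=0$ for every nanophrase $p$ with more than $m$ semi-letters; the least such $m$ is the degree of $v$. The $T$ invariant. An orientation $\alpha_o$ of $\alpha$ is a subset meeting each $\tau$-orbit in exactly one element; fix one. For an $n$-component nanophrase $p$ let $\mathcal{A}(p)$ be its set of letters. Define $n_p(X,X)=0$ and, for distinct letters $X,Y$, $n_p(X,Y)=1$ if $X$ and $Y$ appear alternating in $p$ starting with $X$, $-1$ if they appear alternating in $p$ starting with $Y$, and $0$ if they do not appear alternating. For $a\in\alpha$ put $\varepsilon_a(X)=1$ if $|X|=a$, $-1$ if $|X|=\tau(a)\neq a$, and $0$ otherwise. For $a,b\in\alpha$ put $t_p(a,b,X)=\sum_{Y\in\mathcal{A}(p)}\varepsilon_a(X)\varepsilon_b(Y)n_p(X,Y)$. Let $\mathcal{A}_i(p)$ be the set of letters both of whose occurrences are in the $i$th component of $p$. Define $T^i_{a,b}(p)=\sum_{A\in\mathcal{A}_i(p)}t_p(a,b,A)$, taken in $\mathbb{Z}$ if $a\neq\tau(a)$ and $b\neq\tau(b)$, and taken modulo $2$ in $\mathbb{Z}/2\mathbb{Z}$ otherwise. $T^i(p)$ is the tuple of all $T^i_{a,b}(p)$ with $a,b\in\alpha_o$, and Fukunaga's $T$ invariant is the $n$-tuple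 $T(p)=(T^1(p),\dots,T^n(p))$. Fukunaga proved that each $T^i_{a,b}$ is a homotopy invariant when $S$ is diagonal.
   Formalization: Degree exactly 2 is asserted only when α is non-empty and, if n = 1, α has at least two τ-orbits; in the excluded cases T is identically zero, so its degree is not 2. That T is finite type and vanishes on more than 2 semi-letters is asserted always. *)

theory Defs
  imports
    "HOL-Library.Infinite_Typeclass"
    "HOL-Algebra.Free_Abelian_Groups"
    "HOL-Algebra.Product_Groups"
begin

section \<open>Nanophrases\<close>

text \<open>
  A phrase is the list of its components together with the map \<open>A \<mapsto> |A|\<close>. That map is a total
  function of which only the values on the letters of the phrase matter: phrases which differ
  only in the values of the map elsewhere are isomorphic (via the identity), hence homotopic.
\<close>

type_synonym ('l, 'a) phrase = "'l list list \<times> ('l \<Rightarrow> 'a)"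

definition letters :: "('l, 'a) phrase \<Rightarrow> 'l set" where
  "letters p = set (concat (fst p))"

definition nanophrase :: "'a set \<Rightarrow> nat \<Rightarrow> ('l, 'a) phrase \<Rightarrow> bool" where
  "nanophrase \<alpha> n p \<longleftrightarrow>
     length (fst p) = n \<and>
     (\<forall>A\<in>letters p. count_list (concat (fst p)) A = 2) \<and>
     (\<forall>A\<in>letters p. snd p A \<in> \<alpha>)"

text \<open>
  The sequence of words written out as one sequence of symbols, with \<open>Bar\<close> for the separating
  symbol. For a fixed positive number of components this is injective.
\<close>

datatype 'l symbol = Ltr 'l | Bar

fun flat :: "'l list list \<Rightarrow> 'l symbol list" where
  "flat [] = []"
| "flat [w] = map Ltr w"
| "flat (w # v # ws) = map Ltr w @ Bar # flat (v # ws)"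

definition isomorphic :: "('l, 'a) phrase \<Rightarrow> ('l, 'a) phrase \<Rightarrow> bool" where
  "isomorphic p q \<longleftrightarrow>
     (\<exists>\<sigma>. bij_betw \<sigma> (letters p) (letters q) \<and>
          (\<forall>A\<in>letters p. snd q (\<sigma> A) = snd p A) \<and>
          fst q = map (map \<sigma>) (fst p))"


section \<open>Homotopy\<close>

text \<open>
  In the moves, \<open>x\<close>, \<open>y\<close>, \<open>z\<close>, \<open>t\<close> are sequences of symbols and so may contain \<open>Bar\<close>.
\<close>

inductive homotopic ::
    "'a set \<Rightarrow> ('a \<Rightarrow> 'a) \<Rightarrow> ('a \<times> 'a \<times> 'a) set \<Rightarrow> nat \<Rightarrow>
     ('l, 'a) phrase \<Rightarrow> ('l, 'a) phrase \<Rightarrow> bool"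
  for \<alpha> \<tau> S n where
  iso: "nanophrase \<alpha> n p \<Longrightarrow> nanophrase \<alpha> n q \<Longrightarrow> isomorphic p q \<Longrightarrow> homotopic \<alpha> \<tau> S n p q"
| H1: "nanophrase \<alpha> n (ws, f) \<Longrightarrow> nanophrase \<alpha> n (ws', f) \<Longrightarrow>
       flat ws = x @ [Ltr A, Ltr A] @ y \<Longrightarrow>
       flat ws' = x @ y \<Longrightarrow>
       homotopic \<alpha> \<tau> S n (ws, f) (ws', f)"
| H2: "nanophrase \<alpha> n (ws, f) \<Longrightarrow> nanophrase \<alpha> n (ws', f) \<Longrightarrow>
       f A = \<tau> (f B) \<Longrightarrow>
       flat ws = x @ [Ltr A, Ltr B] @ y @ [Ltr B, Ltr A] @ z \<Longrightarrow>
       flat ws' = x @ y @ z \<Longrightarrow>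
       homotopic \<alpha> \<tau> S n (ws, f) (ws', f)"
| H3: "nanophrase \<alpha> n (ws, f) \<Longrightarrow> nanophrase \<alpha> n (ws', f) \<Longrightarrow>
       (f A, f B, f C) \<in> S \<Longrightarrow>
       flat ws = x @ [Ltr A, Ltr B] @ y @ [Ltr A, Ltr C] @ z @ [Ltr B, Ltr C] @ t \<Longrightarrow>
       flat ws' = x @ [Ltr B, Ltr A] @ y @ [Ltr C, Ltr A] @ z @ [Ltr C, Ltr B] @ t \<Longrightarrow>
       homotopic \<alpha> \<tau> S n (ws, f) (ws', f)"
| refl: "nanophrase \<alpha> n p \<Longrightarrow> homotopic \<alpha> \<tau> S n p p"
| sym: "homotopic \<alpha> \<tau> S n p q \<Longrightarrow> homotopic \<alpha> \<tau> S n q p"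
| trans: "homotopic \<alpha> \<tau> S n p q \<Longrightarrow> homotopic \<alpha> \<tau> S n q r \<Longrightarrow> homotopic \<alpha> \<tau> S n p r"

definition homotopy_class ::
    "'a set \<Rightarrow> ('a \<Rightarrow> 'a) \<Rightarrow> ('a \<times> 'a \<times> 'a) set \<Rightarrow> nat \<Rightarrow>
     ('l, 'a) phrase \<Rightarrow> ('l, 'a) phrase set" where
  "homotopy_class \<alpha> \<tau> S n p = {q. homotopic \<alpha> \<tau> S n p q}"


section \<open>Finite type invariants\<close>

text \<open>
  The free abelian group \<open>\<int>P(\<alpha>,\<tau>,S,n)\<close> is
  \<open>free_Abelian_group (homotopy_class \<alpha> \<tau> S n ` Collect (nanophrase \<alpha> n))\<close>;
  its elements have the type \<open>('l, 'a) phrase set \<Rightarrow>\<^sub>0 int\<close>.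
  An additive abelian group is a \<open>comm_group\<close>, written multiplicatively as in the library.
\<close>

definition homotopy_invariant ::
    "'a set \<Rightarrow> ('a \<Rightarrow> 'a) \<Rightarrow> ('a \<times> 'a \<times> 'a) set \<Rightarrow> nat \<Rightarrow>
     ('g, 'm) monoid_scheme \<Rightarrow> (('l, 'a) phrase \<Rightarrow> 'g) \<Rightarrow> bool" where
  "homotopy_invariant \<alpha> \<tau> S n G v \<longleftrightarrow>
     comm_group G \<and>
     (\<forall>p. nanophrase \<alpha> n p \<longrightarrow> v p \<in> carrier G) \<and>
     (\<forall>p q. homotopic \<alpha> \<tau> S n p q \<longrightarrow> v p = v q)"

text \<open>
  For a homotopy invariant \<open>v\<close>, \<open>the_elem (v ` c)\<close> is the common value of \<open>v\<close> on the class \<open>c\<close>.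
\<close>

definition linear_extension ::
    "('g, 'm) monoid_scheme \<Rightarrow> (('l, 'a) phrase \<Rightarrow> 'g) \<Rightarrow>
     (('l, 'a) phrase set \<Rightarrow>\<^sub>0 int) \<Rightarrow> 'g" where
  "linear_extension G v u =
     finprod G (\<lambda>c. the_elem (v ` c) [^]\<^bsub>G\<^esub> Poly_Mapping.lookup u c) (Poly_Mapping.keys u)"

definition delete_letter :: "'l \<Rightarrow> ('l, 'a) phrase \<Rightarrow> ('l, 'a) phrase" where
  "delete_letter A p = (map (removeAll A) (fst p), snd p)"

text \<open>
  \<open>semi_phrase \<alpha> \<tau> S n As p\<close> is the nanophrase \<open>p\<close> in which the letters in the list \<open>As\<close> are
  marked as semi-letters, expanded one semi-letter after the other.
\<close>

fun semi_phrase ::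
    "'a set \<Rightarrow> ('a \<Rightarrow> 'a) \<Rightarrow> ('a \<times> 'a \<times> 'a) set \<Rightarrow> nat \<Rightarrow>
     'l list \<Rightarrow> ('l, 'a) phrase \<Rightarrow> (('l, 'a) phrase set \<Rightarrow>\<^sub>0 int)" where
  "semi_phrase \<alpha> \<tau> S n [] p = frag_of (homotopy_class \<alpha> \<tau> S n p)"
| "semi_phrase \<alpha> \<tau> S n (A # As) p =
     semi_phrase \<alpha> \<tau> S n As p - semi_phrase \<alpha> \<tau> S n As (delete_letter A p)"

definition vanishes_above ::
    "'a set \<Rightarrow> ('a \<Rightarrow> 'a) \<Rightarrow> ('a \<times> 'a \<times> 'a) set \<Rightarrow> nat \<Rightarrow>
     ('g, 'm) monoid_scheme \<Rightarrow> (('l, 'a) phrase \<Rightarrow> 'g) \<Rightarrow> int \<Rightarrow> bool" where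
  "vanishes_above \<alpha> \<tau> S n G v m \<longleftrightarrow>
     (\<forall>p As. nanophrase \<alpha> n p \<and> distinct As \<and> set As \<subseteq> letters p \<and> int (length As) > m \<longrightarrow>
        linear_extension G v (semi_phrase \<alpha> \<tau> S n As p) = \<one>\<^bsub>G\<^esub>)"

definition finite_type_invariant ::
    "'a set \<Rightarrow> ('a \<Rightarrow> 'a) \<Rightarrow> ('a \<times> 'a \<times> 'a) set \<Rightarrow> nat \<Rightarrow>
     ('g, 'm) monoid_scheme \<Rightarrow> (('l, 'a) phrase \<Rightarrow> 'g) \<Rightarrow> bool" where
  "finite_type_invariant \<alpha> \<tau> S n G v \<longleftrightarrow>
     homotopy_invariant \<alpha> \<tau> S n G v \<and> (\<exists>m. vanishes_above \<alpha> \<tau> S n G v m)"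

definition has_degree ::
    "'a set \<Rightarrow> ('a \<Rightarrow> 'a) \<Rightarrow> ('a \<times> 'a \<times> 'a) set \<Rightarrow> nat \<Rightarrow>
     ('g, 'm) monoid_scheme \<Rightarrow> (('l, 'a) phrase \<Rightarrow> 'g) \<Rightarrow> int \<Rightarrow> bool" where
  "has_degree \<alpha> \<tau> S n G v m \<longleftrightarrow>
     vanishes_above \<alpha> \<tau> S n G v m \<and> (\<forall>k. vanishes_above \<alpha> \<tau> S n G v k \<longrightarrow> m \<le> k)"


section \<open>Fukunaga's T invariant\<close>

definition involution_on :: "'a set \<Rightarrow> ('a \<Rightarrow> 'a) \<Rightarrow> bool" where
  "involution_on \<alpha> \<tau> \<longleftrightarrow> (\<forall>a\<in>\<alpha>. \<tau> a \<in> \<alpha> \<and> \<tau> (\<tau> a) = a)"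

definition orientation :: "'a set \<Rightarrow> ('a \<Rightarrow> 'a) \<Rightarrow> 'a set \<Rightarrow> bool" where
  "orientation \<alpha> \<tau> \<alpha>\<^sub>o \<longleftrightarrow> \<alpha>\<^sub>o \<subseteq> \<alpha> \<and> (\<forall>a\<in>\<alpha>. \<exists>!b. b \<in> \<alpha>\<^sub>o \<and> b \<in> {a, \<tau> a})"

definition alternation :: "('l, 'a) phrase \<Rightarrow> 'l \<Rightarrow> 'l \<Rightarrow> int" where
  "alternation p X Y =
     (let w = filter (\<lambda>Z. Z = X \<or> Z = Y) (concat (fst p)) in
      if X = Y then 0
      else if w = [X, Y, X, Y] then 1
      else if w = [Y, X, Y, X] then -1
      else 0)"

definition letter_sign :: "('a \<Rightarrow> 'a) \<Rightarrow> ('l, 'a) phrase \<Rightarrow> 'a \<Rightarrow> 'l \<Rightarrow> int" where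
  "letter_sign \<tau> p a X =
     (if snd p X = a then 1 else if snd p X = \<tau> a \<and> \<tau> a \<noteq> a then -1 else 0)"

definition letter_linking :: "('a \<Rightarrow> 'a) \<Rightarrow> ('l, 'a) phrase \<Rightarrow> 'a \<Rightarrow> 'a \<Rightarrow> 'l \<Rightarrow> int" where
  "letter_linking \<tau> p a b X =
     (\<Sum>Y\<in>letters p. letter_sign \<tau> p a X * letter_sign \<tau> p b Y * alternation p X Y)"

text \<open>Components are numbered from \<open>0\<close>.\<close>

definition component_letters :: "('l, 'a) phrase \<Rightarrow> nat \<Rightarrow> 'l set" where
  "component_letters p i = {A \<in> letters p. count_list (fst p ! i) A = 2}"

definition T_group :: "('a \<Rightarrow> 'a) \<Rightarrow> 'a \<Rightarrow> 'a \<Rightarrow> int monoid" where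
  "T_group \<tau> a b = (if a \<noteq> \<tau> a \<and> b \<noteq> \<tau> b then integer_group else integer_mod_group 2)"

definition T_component :: "('a \<Rightarrow> 'a) \<Rightarrow> nat \<Rightarrow> 'a \<Rightarrow> 'a \<Rightarrow> ('l, 'a) phrase \<Rightarrow> int" where
  "T_component \<tau> i a b p =
     (let s = \<Sum>A\<in>component_letters p i. letter_linking \<tau> p a b A in
      if a \<noteq> \<tau> a \<and> b \<noteq> \<tau> b then s else s mod 2)"

definition T_codomain ::
    "('a \<Rightarrow> 'a) \<Rightarrow> 'a set \<Rightarrow> nat \<Rightarrow> (nat \<Rightarrow> 'a \<times> 'a \<Rightarrow> int) monoid" where
  "T_codomain \<tau> \<alpha>\<^sub>o n =
     product_group {..<n} (\<lambda>_. product_group (\<alpha>\<^sub>o \<times> \<alpha>\<^sub>o) (\<lambda>(a, b). T_group \<tau> a b))"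

definition T_invariant ::
    "('a \<Rightarrow> 'a) \<Rightarrow> 'a set \<Rightarrow> nat \<Rightarrow> ('l, 'a) phrase \<Rightarrow> (nat \<Rightarrow> 'a \<times> 'a \<Rightarrow> int)" where
  "T_invariant \<tau> \<alpha>\<^sub>o n p =
     (\<lambda>i\<in>{..<n}. \<lambda>(a, b)\<in>\<alpha>\<^sub>o \<times> \<alpha>\<^sub>o. T_component \<tau> i a b p)"

text \<open>
  If \<open>\<alpha>\<close> is empty, or if \<open>n = 1\<close> and \<open>\<alpha>\<close> is a single \<open>\<tau>\<close>-orbit, then \<open>T\<close> is identically zero
  (in the second case because \<open>alternation\<close> is antisymmetric), so that its degree is not \<open>2\<close>.
  The following condition excludes exactly these cases.
\<close>

definition T_nondegenerate :: "'a set \<Rightarrow> ('a \<Rightarrow> 'a) \<Rightarrow> nat \<Rightarrow> bool" where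
  "T_nondegenerate \<alpha> \<tau> n \<longleftrightarrow>
     \<alpha> \<noteq> {} \<and> (n = 1 \<longrightarrow> (\<exists>a\<in>\<alpha>. \<exists>b\<in>\<alpha>. b \<notin> {a, \<tau> a}))"

end

theory Submission
  imports Defs
begin

text \<open>
  Each entry \<open>T\<^sup>i\<^sub>a\<^sub>,\<^sub>b\<close> is the reduction (to \<open>\<int>\<close> or to \<open>\<int>/2\<close>) of an integer which is a sum over ordered
  pairs of letters, and the term of a pair depends only on the labels and the occurrences of
  these two letters, not on the rest of the phrase. Everything follows from this.

  Invariance compares the pairs touched by a move. A letter removed by H1 alternates with no
  other letter. The two letters removed by H2 alternate with the same letters, and the involution
  makes their signs opposite, or equal when the label in question is a fixed point; so their
  terms cancel in \<open>\<int>\<close> or double, and the doubled terms only occur in the entries taken modulo \<open>2\<close>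
  (\<open>pair_sum_H2\<close>). In H3 the three letters carry the same label since \<open>S\<close> is diagonal, and the
  change in their mutual alternations balances (\<open>pair_sum_H3\<close>).

  Deleting a letter removes exactly the terms of the pairs containing it. Hence marking letters
  as semi-letters leaves the sum over the pairs which contain all of them
  (\<open>linear_extension_semi_phrase\<close>). No pair contains three distinct letters, so \<open>T\<close> vanishes above
  \<open>2\<close>. With two semi-letters \<open>A\<close> and \<open>B\<close> in a phrase that reads \<open>ABAB\<close>, only the terms of \<open>(A, B)\<close>
  and \<open>(B, A)\<close> remain. The second is killed either by writing the phrase as \<open>ABA|B|\<dots>\<close>, so that
  \<open>B\<close> does not lie in one component, or by labels from different orbits; the first is then \<open>1\<close>
  (\<open>degree_ge_2\<close>).
\<close>

section \<open>Sums over pairs of letters\<close>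

definition label_sign :: "('a \<Rightarrow> 'a) \<Rightarrow> 'a \<Rightarrow> 'a \<Rightarrow> int" where
  "label_sign \<tau> a x = (if x = a then 1 else if x = \<tau> a \<and> \<tau> a \<noteq> a then -1 else 0)"

definition word_alternation :: "'l list \<Rightarrow> 'l \<Rightarrow> 'l \<Rightarrow> int" where
  "word_alternation u X Y =
     (let w = filter (\<lambda>Z. Z = X \<or> Z = Y) u in
      if X = Y then 0
      else if w = [X, Y, X, Y] then 1
      else if w = [Y, X, Y, X] then -1
      else 0)"

text \<open>
  The predicate \<open>c\<close> stands for lying in the component under consideration. Keeping it abstract
  separates the alternation of letters, which is a matter of the concatenated word, from the
  position of the bars.
\<close>

definition pair_term ::
    "('a \<Rightarrow> 'a) \<Rightarrow> 'a \<Rightarrow> 'a \<Rightarrow> ('l \<Rightarrow> 'a) \<Rightarrow> ('l \<Rightarrow> bool) \<Rightarrow> 'l list \<Rightarrow> 'l \<Rightarrow> 'l \<Rightarrow> int" where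
  "pair_term \<tau> a b f c u X Y =
     (if c X then label_sign \<tau> a (f X) * label_sign \<tau> b (f Y) * word_alternation u X Y else 0)"

definition pair_sum ::
    "('a \<Rightarrow> 'a) \<Rightarrow> 'a \<Rightarrow> 'a \<Rightarrow> ('l \<Rightarrow> 'a) \<Rightarrow> ('l \<Rightarrow> bool) \<Rightarrow> 'l list \<Rightarrow> int" where
  "pair_sum \<tau> a b f c u = (\<Sum>X\<in>set u. \<Sum>Y\<in>set u. pair_term \<tau> a b f c u X Y)"

definition T_reduce :: "('a \<Rightarrow> 'a) \<Rightarrow> 'a \<Rightarrow> 'a \<Rightarrow> int \<Rightarrow> int" where
  "T_reduce \<tau> a b s = (if a \<noteq> \<tau> a \<and> b \<noteq> \<tau> b then s else s mod 2)"

definition in_component :: "'l list list \<Rightarrow> nat \<Rightarrow> 'l \<Rightarrow> bool" where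
  "in_component ws i X \<longleftrightarrow> count_list (ws ! i) X = 2"

lemma T_component_eq_pair_sum:
  "T_component \<tau> i a b p =
     T_reduce \<tau> a b (pair_sum \<tau> a b (snd p) (in_component (fst p) i) (concat (fst p)))"
proof -
  have "(\<Sum>A\<in>component_letters p i. letter_linking \<tau> p a b A) =
        (\<Sum>X\<in>letters p. if in_component (fst p) i X then letter_linking \<tau> p a b X else 0)"
    unfolding component_letters_def in_component_def
    by (subst sum.inter_filter[symmetric]) (auto simp: letters_def)
  also have "\<dots> = pair_sum \<tau> a b (snd p) (in_component (fst p) i) (concat (fst p))"
    unfolding pair_sum_def
    by (intro sum.cong)
       (auto simp: letters_def letter_linking_def pair_term_def label_sign_def letter_sign_def
          word_alternation_def alternation_def intro!: sum.cong)
  finally show ?thesis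
    by (simp add: T_component_def T_reduce_def Let_def)
qed

lemma word_alternation_same [simp]: "word_alternation u X X = 0"
  by (simp add: word_alternation_def)

lemma word_alternation_swap: "word_alternation u Y X = - word_alternation u X Y"
proof -
  have "filter (\<lambda>Z. Z = Y \<or> Z = X) u = filter (\<lambda>Z. Z = X \<or> Z = Y) u"
    by (rule filter_cong) auto
  then show ?thesis
    by (auto simp: word_alternation_def Let_def)
qed

lemma word_alternation_cong:
  "filter (\<lambda>Z. Z = X \<or> Z = Y) u = filter (\<lambda>Z. Z = X \<or> Z = Y) v \<Longrightarrow>
   word_alternation u X Y = word_alternation v X Y"
  by (simp add: word_alternation_def)

lemma filter_eq_replicate_count: "filter (\<lambda>Z. Z = Y) u = replicate (count_list u Y) Y"
  by (induction u) auto

lemma replicate_eq_single: "replicate k Y = [Y] \<longleftrightarrow> k = 1"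
  by (cases k) auto

text \<open>
  The occurrences of \<open>X\<close> cut the word into three pieces, and only the number of occurrences of
  \<open>Y\<close> in each piece matters. Exchanging adjacent letters other than \<open>Y\<close> changes none of these
  numbers; this is what makes the moves tractable.
\<close>

lemma word_alternation_cut:
  assumes "X \<notin> set u" "X \<notin> set v" "X \<notin> set w" "X \<noteq> Y"
  shows "word_alternation (u @ X # v @ X # w) X Y =
    (if count_list u Y = 0 \<and> count_list v Y = 1 \<and> count_list w Y = 1 then 1
     else if count_list u Y = 1 \<and> count_list v Y = 1 \<and> count_list w Y = 0 then -1 else 0)"
proof -
  have f: "filter (\<lambda>Z. Z = X \<or> Z = Y) s = replicate (count_list s Y) Y" if "X \<notin> set s" for s
  proof -
    have "filter (\<lambda>Z. Z = X \<or> Z = Y) s = filter (\<lambda>Z. Z = Y) s"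
      using that by (intro filter_cong) auto
    then show ?thesis by (simp add: filter_eq_replicate_count)
  qed
  have 1: "replicate i Y @ X # replicate j Y @ X # replicate k Y = [X, Y, X, Y] \<longleftrightarrow>
           i = 0 \<and> j = 1 \<and> k = 1" for i j k
    using assms(4)
    by (cases i; cases j; cases "j - 1") (auto simp: replicate_eq_single)
  have 2: "replicate i Y @ X # replicate j Y @ X # replicate k Y = [Y, X, Y, X] \<longleftrightarrow>
           i = 1 \<and> j = 1 \<and> k = 0" for i j k
    using assms(4)
    by (cases i; cases "i - 1"; cases j; cases "j - 1") (auto simp: replicate_eq_single)
  show ?thesis
    using assms unfolding word_alternation_def by (simp add: f 1 2)
qed

lemma pair_term_same [simp]: "pair_term \<tau> a b f c u X X = 0"
  by (simp add: pair_term_def)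

lemma double_sum_insert:
  fixes g :: "'l \<Rightarrow> 'l \<Rightarrow> int"
  assumes "finite L" "A \<notin> L"
  shows "(\<Sum>X\<in>insert A L. \<Sum>Y\<in>insert A L. g X Y) =
    g A A + (\<Sum>Y\<in>L. g A Y + g Y A) + (\<Sum>X\<in>L. \<Sum>Y\<in>L. g X Y)"
  using assms by (simp add: sum.distrib)


section \<open>The moves on words\<close>

lemma pair_sum_H1:
  assumes A: "A \<notin> set x" "A \<notin> set y"
    and c: "\<And>X. X \<noteq> A \<Longrightarrow> c X = c' X"
  shows "pair_sum \<tau> a b f c (x @ A # A # y) = pair_sum \<tau> a b f c' (x @ y)"
proof -
  let ?u = "x @ A # A # y" and ?L = "set (x @ y)"
  have A0: "word_alternation ?u A Y = 0" if "Y \<noteq> A" for Y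
    using word_alternation_cut[of A x "[]" y Y] A that by simp
  have A1: "word_alternation ?u Y A = 0" if "Y \<noteq> A" for Y
    using A0[OF that] word_alternation_swap[of ?u Y A] by simp
  have old: "pair_term \<tau> a b f c ?u X Y = pair_term \<tau> a b f c' (x @ y) X Y"
    if "X \<in> ?L" "Y \<in> ?L" for X Y
  proof -
    have ne: "X \<noteq> A" "Y \<noteq> A" using that A by auto
    then have "word_alternation ?u X Y = word_alternation (x @ y) X Y"
      by (intro word_alternation_cong) simp
    then show ?thesis using c[OF ne(1)] by (simp add: pair_term_def)
  qed
  have "set ?u = insert A ?L" by auto
  then have "pair_sum \<tau> a b f c ?u = (\<Sum>X\<in>insert A ?L. \<Sum>Y\<in>insert A ?L. pair_term \<tau> a b f c ?u X Y)"
    by (simp add: pair_sum_def)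
  also have "\<dots> = (\<Sum>Y\<in>?L. pair_term \<tau> a b f c ?u A Y + pair_term \<tau> a b f c ?u Y A)
      + (\<Sum>X\<in>?L. \<Sum>Y\<in>?L. pair_term \<tau> a b f c ?u X Y)"
    using A by (subst double_sum_insert) auto
  also have "(\<Sum>Y\<in>?L. pair_term \<tau> a b f c ?u A Y + pair_term \<tau> a b f c ?u Y A) = 0"
  proof (intro sum.neutral ballI)
    fix Y assume "Y \<in> ?L"
    then have "Y \<noteq> A" using A by auto
    then show "pair_term \<tau> a b f c ?u A Y + pair_term \<tau> a b f c ?u Y A = 0"
      by (simp add: pair_term_def A0 A1)
  qed
  also have "(\<Sum>X\<in>?L. \<Sum>Y\<in>?L. pair_term \<tau> a b f c ?u X Y) = pair_sum \<tau> a b f c' (x @ y)"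
    unfolding pair_sum_def by (rule sum.cong[OF HOL.refl], rule sum.cong[OF HOL.refl], rule old)
  finally show ?thesis by simp
qed

lemma label_sign_involution:
  assumes "involution_on \<alpha> \<tau>" "a \<in> \<alpha>" "x \<in> \<alpha>"
  shows "label_sign \<tau> a (\<tau> x) = (if \<tau> a = a then label_sign \<tau> a x else - label_sign \<tau> a x)"
proof -
  have "\<tau> x = a \<longleftrightarrow> x = \<tau> a" "\<tau> x = \<tau> a \<longleftrightarrow> x = a"
    using assms unfolding involution_on_def by metis+
  then show ?thesis by (auto simp: label_sign_def)
qed

lemma T_reduce_cancel:
  assumes "\<tau> a \<noteq> a \<Longrightarrow> \<tau> b \<noteq> b \<Longrightarrow> d = 0" "even d"
  shows "T_reduce \<tau> a b (d + s) = T_reduce \<tau> a b s"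
proof -
  have "(d + s) mod 2 = s mod 2" using assms(2) by presburger
  then show ?thesis using assms(1) by (auto simp: T_reduce_def)
qed

text \<open>
  \<open>A\<close> and \<open>B\<close> alternate with the same letters and not with each other. For a first or second
  index that is not a fixed point of \<open>\<tau>\<close> their terms cancel; for a fixed point they are equal and
  add up to an even number, which disappears because such an index forces reduction modulo \<open>2\<close>.
\<close>

lemma pair_sum_H2:
  assumes inv: "involution_on \<alpha> \<tau>" and ab: "a \<in> \<alpha>" "b \<in> \<alpha>"
    and lab: "f A = \<tau> (f B)" "f B \<in> \<alpha>"
    and new: "A \<notin> set (x @ y @ z)" "B \<notin> set (x @ y @ z)" "A \<noteq> B"
    and c: "\<And>X. X \<noteq> A \<Longrightarrow> X \<noteq> B \<Longrightarrow> c X = c' X" "c A = c B"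
  shows "T_reduce \<tau> a b (pair_sum \<tau> a b f c (x @ A # B # y @ B # A # z)) =
         T_reduce \<tau> a b (pair_sum \<tau> a b f c' (x @ y @ z))"
proof -
  let ?u = "x @ A # B # y @ B # A # z" and ?L = "set (x @ y @ z)"
  let ?g = "pair_term \<tau> a b f c ?u"
  have twins: "word_alternation ?u A Y = word_alternation ?u B Y" if "Y \<in> ?L" for Y
  proof -
    have ne: "Y \<noteq> A" "Y \<noteq> B" using that new by auto
    show ?thesis
      using word_alternation_cut[of A x "B # y @ [B]" z Y]
        word_alternation_cut[of B "x @ [A]" y "A # z" Y] new ne by simp
  qed
  have twins': "word_alternation ?u Y A = word_alternation ?u Y B" if "Y \<in> ?L" for Y
    using twins[OF that] word_alternation_swap[of ?u Y] by metis
  have AB: "word_alternation ?u A B = 0"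
    using word_alternation_cut[of A x "B # y @ [B]" z B] new by simp
  then have BA: "word_alternation ?u B A = 0"
    using word_alternation_swap[of ?u B A] by simp
  have old: "?g X Y = pair_term \<tau> a b f c' (x @ y @ z) X Y"
    if "X \<in> ?L" "Y \<in> ?L" for X Y
  proof -
    have ne: "X \<noteq> A" "Y \<noteq> A" "X \<noteq> B" "Y \<noteq> B" using that new by auto
    then have "word_alternation ?u X Y = word_alternation (x @ y @ z) X Y"
      by (intro word_alternation_cong) simp
    then show ?thesis using c(1)[OF ne(1,3)] by (simp add: pair_term_def)
  qed
  \<comment> \<open>what the pairs meeting both the removed and the remaining letters contribute\<close>
  define d where "d = (\<Sum>Y\<in>?L. (?g A Y + ?g B Y) + (?g Y A + ?g Y B))"
  have "set ?u = insert A (insert B ?L)" by auto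
  then have "pair_sum \<tau> a b f c ?u =
      (\<Sum>X\<in>insert A (insert B ?L). \<Sum>Y\<in>insert A (insert B ?L). ?g X Y)"
    by (simp add: pair_sum_def)
  also have "\<dots> = (\<Sum>Y\<in>insert B ?L. ?g A Y + ?g Y A)
      + (\<Sum>X\<in>insert B ?L. \<Sum>Y\<in>insert B ?L. ?g X Y)"
    using new by (subst double_sum_insert) auto
  also have "(\<Sum>X\<in>insert B ?L. \<Sum>Y\<in>insert B ?L. ?g X Y) =
      (\<Sum>Y\<in>?L. ?g B Y + ?g Y B) + (\<Sum>X\<in>?L. \<Sum>Y\<in>?L. ?g X Y)"
    using new by (subst double_sum_insert) auto
  also have "(\<Sum>Y\<in>insert B ?L. ?g A Y + ?g Y A) = (\<Sum>Y\<in>?L. ?g A Y + ?g Y A)"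
    using new AB BA by (subst sum.insert) (auto simp: pair_term_def)
  also have "(\<Sum>X\<in>?L. \<Sum>Y\<in>?L. ?g X Y) = pair_sum \<tau> a b f c' (x @ y @ z)"
    unfolding pair_sum_def by (rule sum.cong[OF HOL.refl], rule sum.cong[OF HOL.refl], rule old)
  finally have eq: "pair_sum \<tau> a b f c ?u = d + pair_sum \<tau> a b f c' (x @ y @ z)"
    by (simp add: d_def sum.distrib)
  have sA: "label_sign \<tau> e (f A) = (if \<tau> e = e then label_sign \<tau> e (f B) else - label_sign \<tau> e (f B))"
    if "e \<in> \<alpha>" for e
    using label_sign_involution[OF inv that lab(2)] lab(1) by simp
  have gA: "?g A Y + ?g B Y = (if \<tau> a = a then 2 * ?g B Y else 0)" if "Y \<in> ?L" for Y
    using twins[OF that] c(2) sA[OF ab(1)] by (auto simp: pair_term_def)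
  have gB: "?g Y A + ?g Y B = (if \<tau> b = b then 2 * ?g Y B else 0)" if "Y \<in> ?L" for Y
    using twins'[OF that] sA[OF ab(2)] by (auto simp: pair_term_def)
  have d: "d = (\<Sum>Y\<in>?L. (if \<tau> a = a then 2 * ?g B Y else 0) + (if \<tau> b = b then 2 * ?g Y B else 0))"
    unfolding d_def by (intro sum.cong HOL.refl) (simp only: gA gB)
  show ?thesis
    unfolding eq
  proof (rule T_reduce_cancel)
    show "even d" unfolding d by (intro dvd_sum) auto
    show "d = 0" if "\<tau> a \<noteq> a" "\<tau> b \<noteq> b" unfolding d using that by simp
  qed
qed

text \<open>
  Before the move \<open>A\<close> alternates with \<open>B\<close> and \<open>B\<close> with \<open>C\<close>; after it only \<open>A\<close> alternates with
  \<open>C\<close>. As the three signs agree, the two terms with first letter \<open>B\<close> cancel, and on both sides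
  what is left counts \<open>A\<close> positively and \<open>C\<close> negatively, whichever components these letters
  lie in.
\<close>

lemma pair_sum_H3:
  assumes lab: "f A = f B" "f B = f C"
    and new: "A \<notin> set (x @ y @ z @ t)" "B \<notin> set (x @ y @ z @ t)" "C \<notin> set (x @ y @ z @ t)"
    and ne: "A \<noteq> B" "A \<noteq> C" "B \<noteq> C"
  shows "pair_sum \<tau> a b f c (x @ A # B # y @ A # C # z @ B # C # t) =
         pair_sum \<tau> a b f c (x @ B # A # y @ C # A # z @ C # B # t)"
proof -
  let ?u = "x @ A # B # y @ A # C # z @ B # C # t"
  let ?v = "x @ B # A # y @ C # A # z @ C # B # t"
  let ?g = "pair_term \<tau> a b f c ?u" and ?h = "pair_term \<tau> a b f c ?v"
  let ?E = "{A, B, C}"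
  note ne' = ne[symmetric]
  \<comment> \<open>the two words in the form to which the cutting lemma applies, for each of the three letters\<close>
  have cutA: "word_alternation ?u A Y = word_alternation (x @ A # (B # y) @ A # (C # z @ B # C # t)) A Y"
       "word_alternation ?v A Y = word_alternation ((x @ [B]) @ A # (y @ [C]) @ A # (z @ C # B # t)) A Y"
     and cutB: "word_alternation ?u B Y = word_alternation ((x @ [A]) @ B # (y @ A # C # z) @ B # (C # t)) B Y"
       "word_alternation ?v B Y = word_alternation (x @ B # (A # y @ C # A # z @ [C]) @ B # t) B Y"
     and cutC: "word_alternation ?u C Y = word_alternation ((x @ A # B # y @ [A]) @ C # (z @ [B]) @ C # t) C Y"
       "word_alternation ?v C Y = word_alternation ((x @ B # A # y) @ C # (A # z) @ C # (B # t)) C Y" for Y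
    by simp_all
  have zero: "count_list (x @ y @ z @ t) A = 0" "count_list (x @ y @ z @ t) B = 0"
       "count_list (x @ y @ z @ t) C = 0"
    using new by (auto simp: count_list_0_iff)
  have alternations: "word_alternation ?u A B = 1" "word_alternation ?u A C = 0" "word_alternation ?u B C = 1"
       "word_alternation ?v A B = 0" "word_alternation ?v A C = 1" "word_alternation ?v B C = 0"
    unfolding cutA cutB
    by (subst word_alternation_cut; use new ne ne' zero in simp)+
  have outside: "word_alternation ?u X Y = word_alternation ?v X Y" if "X \<in> ?E" "Y \<notin> ?E" for X Y
  proof -
    have "word_alternation ?u A Y = word_alternation ?v A Y"
      unfolding cutA using new ne ne' that by (subst (1 2) word_alternation_cut) auto
    moreover have "word_alternation ?u B Y = word_alternation ?v B Y"
      unfolding cutB using new ne ne' that by (subst (1 2) word_alternation_cut) auto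
    moreover have "word_alternation ?u C Y = word_alternation ?v C Y"
      unfolding cutC using new ne ne' that by (subst (1 2) word_alternation_cut) auto
    ultimately show ?thesis using that by auto
  qed
  have same: "word_alternation ?u X Y = word_alternation ?v X Y" if "X \<notin> ?E \<or> Y \<notin> ?E" for X Y
  proof (cases "X \<in> ?E \<or> Y \<in> ?E")
    case True
    then show ?thesis
      using that outside[of X Y] outside[of Y X] word_alternation_swap[of ?u X Y]
        word_alternation_swap[of ?v X Y] by auto
  next
    case False
    then show ?thesis by (intro word_alternation_cong) auto
  qed
  have outside_zero: "?g X Y - ?h X Y = 0" if "X \<notin> ?E \<or> Y \<notin> ?E" for X Y
    by (simp add: pair_term_def same[OF that])
  have sets: "set ?v = set ?u" by auto
  have "pair_sum \<tau> a b f c ?u - pair_sum \<tau> a b f c ?v =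
      (\<Sum>X\<in>set ?u. \<Sum>Y\<in>set ?u. ?g X Y - ?h X Y)"
    unfolding pair_sum_def sets by (simp add: sum_subtractf)
  also have "\<dots> = (\<Sum>X\<in>?E. \<Sum>Y\<in>set ?u. ?g X Y - ?h X Y)"
    by (rule sum.mono_neutral_right) (simp, force, use outside_zero in simp)
  also have "\<dots> = (\<Sum>X\<in>?E. \<Sum>Y\<in>?E. ?g X Y - ?h X Y)"
    by (rule sum.cong[OF HOL.refl], rule sum.mono_neutral_right) (simp, force, use outside_zero in simp)
  also have "\<dots> = 0"
    using ne ne' lab alternations word_alternation_swap[of ?u B A] word_alternation_swap[of ?u C A]
      word_alternation_swap[of ?u C B] word_alternation_swap[of ?v B A]
      word_alternation_swap[of ?v C A] word_alternation_swap[of ?v C B]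
    by (simp add: pair_term_def)
  finally show ?thesis by simp
qed

lemma word_alternation_map:
  assumes "inj_on \<sigma> (set u)" "X \<in> set u" "Y \<in> set u"
  shows "word_alternation (map \<sigma> u) (\<sigma> X) (\<sigma> Y) = word_alternation u X Y"
proof -
  let ?w = "filter (\<lambda>Z. Z = X \<or> Z = Y) u"
  have eq: "\<sigma> Z = \<sigma> W \<longleftrightarrow> Z = W" if "Z \<in> set u" "W \<in> set u" for Z W
    using assms(1) that by (auto dest: inj_onD)
  have "filter (\<lambda>Z. Z = \<sigma> X \<or> Z = \<sigma> Y) (map \<sigma> u) = map \<sigma> ?w"
    unfolding filter_map
    by (rule arg_cong[where f = "map \<sigma>"], rule filter_cong) (use assms eq in auto)
  moreover have "map \<sigma> ?w = map \<sigma> s \<longleftrightarrow> ?w = s" if "set s \<subseteq> set u" for s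
    by (rule inj_on_map_eq_map) (rule inj_on_subset[OF assms(1)], use that in auto)
  from this[of "[X, Y, X, Y]"] this[of "[Y, X, Y, X]"]
  have "map \<sigma> ?w = [\<sigma> X, \<sigma> Y, \<sigma> X, \<sigma> Y] \<longleftrightarrow> ?w = [X, Y, X, Y]"
       "map \<sigma> ?w = [\<sigma> Y, \<sigma> X, \<sigma> Y, \<sigma> X] \<longleftrightarrow> ?w = [Y, X, Y, X]"
    using assms by auto
  ultimately show ?thesis
    using eq[OF assms(2,3)] by (simp add: word_alternation_def Let_def)
qed

lemma pair_sum_map:
  assumes "inj_on \<sigma> (set u)" "\<And>X. X \<in> set u \<Longrightarrow> g (\<sigma> X) = f X"
    "\<And>X. X \<in> set u \<Longrightarrow> d (\<sigma> X) = c X"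
  shows "pair_sum \<tau> a b g d (map \<sigma> u) = pair_sum \<tau> a b f c u"
proof -
  have "pair_term \<tau> a b g d (map \<sigma> u) (\<sigma> X) (\<sigma> Y) = pair_term \<tau> a b f c u X Y"
    if "X \<in> set u" "Y \<in> set u" for X Y
    using assms that by (simp add: pair_term_def word_alternation_map)
  then show ?thesis
    using assms(1) by (simp add: pair_sum_def sum.reindex)
qed

lemma count_list_map_inj_on:
  assumes "inj_on \<sigma> (insert X (set u))"
  shows "count_list (map \<sigma> u) (\<sigma> X) = count_list u X"
  using assms by (induction u) (auto simp: inj_on_def)

lemma word_alternation_removeAll:
  assumes "X \<noteq> A" "Y \<noteq> A"
  shows "word_alternation (removeAll A u) X Y = word_alternation u X Y"
proof -
  have "filter (\<lambda>Z. Z = X \<or> Z = Y) (removeAll A u) = filter (\<lambda>Z. Z = X \<or> Z = Y) u"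
    using assms unfolding removeAll_filter_not_eq filter_filter by (intro filter_cong) auto
  then show ?thesis by (rule word_alternation_cong)
qed

lemma count_list_removeAll: "X \<noteq> A \<Longrightarrow> count_list (removeAll A u) X = count_list u X"
  by (induction u) auto


section \<open>Invariance under homotopy\<close>

text \<open>
  A sequence of symbols with each letter tagged by the component it stands in. Unlike the list of
  components it is compatible with concatenation, so that the moves can be read off from it.
\<close>

fun locate :: "nat \<Rightarrow> 'l symbol list \<Rightarrow> (nat \<times> 'l) list" where
  "locate k [] = []"
| "locate k (Ltr A # s) = (k, A) # locate k s"
| "locate k (Bar # s) = locate (Suc k) s"

lemma locate_append: "locate k (s @ t) = locate k s @ locate (k + count_list s Bar) t"
  by (induction k s rule: locate.induct) auto

lemma locate_map_Ltr: "locate k (map Ltr w) = map (Pair k) w"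
  by (induction w) auto

lemma count_Bar_map_Ltr [simp]: "count_list (map Ltr w) Bar = 0"
  by (induction w) auto

lemma letters_locate_flat: "map snd (locate k (flat ws)) = concat ws"
  by (induction ws arbitrary: k rule: flat.induct)
     (simp_all add: locate_append locate_map_Ltr comp_def)

lemma locate_ge: "(i, A) \<in> set (locate k s) \<Longrightarrow> k \<le> i"
  by (induction k s rule: locate.induct) auto

lemma count_list_Pair: "count_list (map (Pair k) w) (j, A) = (if j = k then count_list w A else 0)"
  by (induction w) auto

lemma count_locate_flat:
  "i < length ws \<Longrightarrow> count_list (locate k (flat ws)) (k + i, A) = count_list (ws ! i) A"
proof (induction ws arbitrary: k i rule: flat.induct)
  case (2 w)
  then show ?case by (simp add: locate_map_Ltr count_list_Pair)
next
  case (3 w v ws)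
  have later: "count_list (locate (Suc k) (flat (v # ws))) (k, A) = 0"
    unfolding count_list_0_iff using locate_ge by fastforce
  show ?case
  proof (cases i)
    case 0
    then show ?thesis using later by (simp add: locate_append locate_map_Ltr count_list_Pair)
  next
    case (Suc j)
    then show ?thesis using "3.IH"[of j "Suc k"] "3.prems"
      by (simp add: locate_append locate_map_Ltr count_list_Pair)
  qed
qed simp

lemma in_component_locate:
  assumes "i < length ws"
  shows "in_component ws i X \<longleftrightarrow> count_list (locate 0 (flat ws)) (i, X) = 2"
  using count_locate_flat[OF assms, of 0 X] by (simp add: in_component_def)

lemma nanophrase_count:
  assumes "nanophrase \<alpha> n (ws, f)" "X \<in> set (concat ws)"
  shows "count_list (concat ws) X = 2" "f X \<in> \<alpha>"
  using assms by (auto simp: nanophrase_def letters_def)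

lemma count_list_tagged_0: "W \<notin> set (map snd V) \<Longrightarrow> count_list V (j, W) = 0"
  by (force simp: count_list_0_iff)

text \<open>
  In each move the tagged words differ exactly as the sequences of symbols do. The two letters of
  an adjacent pair get the same tag, which is why in H2 both lie in the component or neither does,
  and why H3 moves no letter to another component.
\<close>

lemma T_component_homotopic:
  fixes p q :: "('l, 'a) phrase"
  assumes inv: "involution_on \<alpha> \<tau>" and S: "S = {(a, a, a) | a. a \<in> \<alpha>}"
    and ab: "a \<in> \<alpha>" "b \<in> \<alpha>" and i: "i < n"
    and "homotopic \<alpha> \<tau> S n p q"
  shows "T_component \<tau> i a b p = T_component \<tau> i a b q"
  using assms(6)
proof induction
  case (iso p q)
  then obtain \<sigma> where \<sigma>: "bij_betw \<sigma> (letters p) (letters q)"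
      "\<And>A. A \<in> letters p \<Longrightarrow> snd q (\<sigma> A) = snd p A" "fst q = map (map \<sigma>) (fst p)"
    by (auto simp: isomorphic_def)
  have inj: "inj_on \<sigma> (set (concat (fst p)))"
    using \<sigma>(1) by (simp add: bij_betw_def letters_def)
  have len: "i < length (fst p)" using iso i by (simp add: nanophrase_def)
  have comp: "in_component (fst q) i (\<sigma> X) = in_component (fst p) i X"
    if "X \<in> set (concat (fst p))" for X
  proof -
    have "inj_on \<sigma> (insert X (set (fst p ! i)))"
      by (rule inj_on_subset[OF inj]) (use that nth_mem[OF len] in fastforce)
    then show ?thesis
      using len by (simp add: in_component_def \<sigma>(3) count_list_map_inj_on)
  qed
  have "concat (fst q) = map \<sigma> (concat (fst p))" by (simp add: \<sigma>(3) map_concat)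
  then show ?case
    unfolding T_component_eq_pair_sum
    using pair_sum_map[OF inj, of "snd q" "snd p" "in_component (fst q) i"] \<sigma>(2) comp
    by (simp add: letters_def)
next
  case (H1 ws f ws' x A y)
  define k X Y where "k = count_list x Bar" and "X = locate 0 x" and "Y = locate k y"
  have l: "locate 0 (flat ws) = X @ [(k, A), (k, A)] @ Y" "locate 0 (flat ws') = X @ Y"
    by (simp_all add: H1 locate_append k_def X_def Y_def)
  have w: "concat ws = map snd X @ A # A # map snd Y" "concat ws' = map snd X @ map snd Y"
    using letters_locate_flat[of 0 ws] letters_locate_flat[of 0 ws'] l by simp_all
  have "count_list (concat ws) A = 2"
    by (rule nanophrase_count(1)[OF H1(1)]) (simp add: w)
  then have "A \<notin> set (map snd X)" "A \<notin> set (map snd Y)"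
    by (simp_all add: w count_list_0_iff del: set_map)
  moreover have len: "i < length ws" "i < length ws'" using H1(1,2) i by (simp_all add: nanophrase_def)
  have "in_component ws i Z = in_component ws' i Z" if "Z \<noteq> A" for Z
    using that by (auto simp: in_component_locate[OF len(1)] in_component_locate[OF len(2)] l)
  ultimately show ?case
    unfolding T_component_eq_pair_sum
    using pair_sum_H1[of A "map snd X" "map snd Y" "in_component ws i" "in_component ws' i" \<tau> a b f]
    by (simp add: w)
next
  case (H2 ws f ws' A B x y z)
  define k l X Y Z where "k = count_list x Bar" and "l = k + count_list y Bar"
    and "X = locate 0 x" and "Y = locate k y" and "Z = locate l z"
  note defs = k_def l_def X_def Y_def Z_def
  have loc: "locate 0 (flat ws) = X @ [(k, A), (k, B)] @ Y @ [(l, B), (l, A)] @ Z"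
      "locate 0 (flat ws') = X @ Y @ Z"
    by (simp_all add: H2 locate_append defs)
  have w: "concat ws = map snd X @ A # B # map snd Y @ B # A # map snd Z"
      "concat ws' = map snd X @ map snd Y @ map snd Z"
    using letters_locate_flat[of 0 ws] letters_locate_flat[of 0 ws'] loc by simp_all
  have cnt: "count_list (concat ws) A = 2" "count_list (concat ws) B = 2"
    by (rule nanophrase_count(1)[OF H2(1)], simp add: w)+
  have ne: "A \<noteq> B"
  proof
    assume "A = B"
    then show False using cnt(1) by (simp add: w)
  qed
  have new: "A \<notin> set (map snd X @ map snd Y @ map snd Z)"
    "B \<notin> set (map snd X @ map snd Y @ map snd Z)"
    using cnt ne ne[symmetric] by (simp_all add: w count_list_0_iff del: set_map)
  have tag: "count_list X (j, A) = 0 \<and> count_list Y (j, A) = 0 \<and> count_list Z (j, A) = 0 \<and>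
      count_list X (j, B) = 0 \<and> count_list Y (j, B) = 0 \<and> count_list Z (j, B) = 0" for j
    using new by (simp add: count_list_tagged_0 del: set_map)
  have len: "i < length ws" "i < length ws'" using H2(1,2) i by (simp_all add: nanophrase_def)
  note ic = in_component_locate[OF len(1)] in_component_locate[OF len(2)]
  have "in_component ws i W = in_component ws' i W" if "W \<noteq> A" "W \<noteq> B" for W
    using that by (auto simp: ic loc)
  moreover have "in_component ws i A = in_component ws i B"
    using ne ne[symmetric] tag by (simp add: ic loc)
  moreover have "f B \<in> \<alpha>" by (rule nanophrase_count(2)[OF H2(1)]) (simp add: w)
  ultimately show ?case
    unfolding T_component_eq_pair_sum
    using pair_sum_H2[OF inv ab H2(3) _ new ne, of "in_component ws i" "in_component ws' i"]
    by (simp add: w)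
next
  case (H3 ws f ws' A B C x y z t)
  define k l m X Y Z U where "k = count_list x Bar" and "l = k + count_list y Bar"
    and "m = l + count_list z Bar"
    and "X = locate 0 x" and "Y = locate k y" and "Z = locate l z" and "U = locate m t"
  note defs = k_def l_def m_def X_def Y_def Z_def U_def
  have loc: "locate 0 (flat ws) = X @ [(k, A), (k, B)] @ Y @ [(l, A), (l, C)] @ Z @ [(m, B), (m, C)] @ U"
      "locate 0 (flat ws') = X @ [(k, B), (k, A)] @ Y @ [(l, C), (l, A)] @ Z @ [(m, C), (m, B)] @ U"
    by (simp_all add: H3 locate_append defs)
  have w: "concat ws = map snd X @ A # B # map snd Y @ A # C # map snd Z @ B # C # map snd U"
      "concat ws' = map snd X @ B # A # map snd Y @ C # A # map snd Z @ C # B # map snd U"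
    using letters_locate_flat[of 0 ws] letters_locate_flat[of 0 ws'] loc by simp_all
  have cnt: "count_list (concat ws) A = 2" "count_list (concat ws) B = 2" "count_list (concat ws) C = 2"
    by (rule nanophrase_count(1)[OF H3(1)], simp add: w)+
  have ne: "A \<noteq> B" "A \<noteq> C" "B \<noteq> C"
  proof -
    show "A \<noteq> B"
    proof
      assume "A = B"
      then show False using cnt(1) by (simp add: w split: if_splits)
    qed
    show "A \<noteq> C"
    proof
      assume "A = C"
      then show False using cnt(1) by (simp add: w split: if_splits)
    qed
    show "B \<noteq> C"
    proof
      assume "B = C"
      then show False using cnt(2) by (simp add: w split: if_splits)
    qed
  qed
  let ?r = "map snd X @ map snd Y @ map snd Z @ map snd U"
  have new: "A \<notin> set ?r" "B \<notin> set ?r" "C \<notin> set ?r"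
    using cnt ne ne[symmetric] by (simp_all add: w count_list_0_iff del: set_map)
  have len: "i < length ws" "i < length ws'" using H3(1,2) i by (simp_all add: nanophrase_def)
  have swap: "count_list [P, Q] R = count_list [Q, P] R" for P Q R :: "nat \<times> 'l"
    by simp
  have comp: "in_component ws i = in_component ws' i"
    by (rule ext) (simp only: in_component_locate[OF len(1)] in_component_locate[OF len(2)] loc
        count_list_append swap[of "(k, A)" "(k, B)"] swap[of "(l, A)" "(l, C)"]
        swap[of "(m, B)" "(m, C)"])
  have "f A = f B" "f B = f C" using H3(3) S by auto
  then show ?case
    unfolding T_component_eq_pair_sum
    using pair_sum_H3[OF _ _ new ne, of f \<tau> a b "in_component ws' i"]
    by (simp add: w comp)
qed simp_all


section \<open>The target group and the linear extension\<close>

text \<open>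
  Being a homomorphism in the family of integers, this reduction allows all computations to be
  done before passing to the quotients.
\<close>

definition T_element ::
    "('a \<Rightarrow> 'a) \<Rightarrow> 'a set \<Rightarrow> nat \<Rightarrow> (nat \<Rightarrow> 'a \<times> 'a \<Rightarrow> int) \<Rightarrow> (nat \<Rightarrow> 'a \<times> 'a \<Rightarrow> int)" where
  "T_element \<tau> \<alpha>\<^sub>o n s = (\<lambda>i\<in>{..<n}. \<lambda>(a, b)\<in>\<alpha>\<^sub>o \<times> \<alpha>\<^sub>o. T_reduce \<tau> a b (s i (a, b)))"

lemma T_reduce_closed: "T_reduce \<tau> a b s \<in> carrier (T_group \<tau> a b)"
  by (simp add: T_reduce_def T_group_def carrier_integer_mod_group)

lemma T_reduce_add:
  "T_reduce \<tau> a b (s + t) = T_reduce \<tau> a b s \<otimes>\<^bsub>T_group \<tau> a b\<^esub> T_reduce \<tau> a b t"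
  by (simp add: T_reduce_def T_group_def mod_add_eq)

lemma T_element_closed: "T_element \<tau> \<alpha>\<^sub>o n s \<in> carrier (T_codomain \<tau> \<alpha>\<^sub>o n)"
  by (auto simp: T_element_def T_codomain_def T_reduce_closed intro!: restrict_PiE_iff[THEN iffD2])

lemma T_element_add:
  "T_element \<tau> \<alpha>\<^sub>o n (\<lambda>i ab. s i ab + t i ab) =
   T_element \<tau> \<alpha>\<^sub>o n s \<otimes>\<^bsub>T_codomain \<tau> \<alpha>\<^sub>o n\<^esub> T_element \<tau> \<alpha>\<^sub>o n t"
  by (auto simp: T_element_def T_codomain_def T_reduce_add intro!: restrict_ext)

lemma T_element_zero: "T_element \<tau> \<alpha>\<^sub>o n (\<lambda>i ab. 0) = \<one>\<^bsub>T_codomain \<tau> \<alpha>\<^sub>o n\<^esub>"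
  by (auto simp: T_element_def T_codomain_def T_reduce_def T_group_def intro!: restrict_ext)

lemma comm_group_product_group:
  assumes "\<And>i. i \<in> I \<Longrightarrow> comm_group (G i)"
  shows "comm_group (product_group I G)"
proof (rule group.group_comm_groupI)
  show "group (product_group I G)"
    by (rule product_group) (use assms in \<open>simp add: comm_group_def\<close>)
  fix x y assume "x \<in> carrier (product_group I G)" "y \<in> carrier (product_group I G)"
  then show "x \<otimes>\<^bsub>product_group I G\<^esub> y = y \<otimes>\<^bsub>product_group I G\<^esub> x"
    using assms by (auto intro!: restrict_ext comm_monoid.m_comm simp: comm_group_def PiE_iff)
qed

lemma comm_group_T_codomain: "comm_group (T_codomain \<tau> \<alpha>\<^sub>o n)"
  unfolding T_codomain_def
  by (intro comm_group_product_group) (auto simp: T_group_def abelian_integer_group)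

lemma (in comm_group) finprod_pow_superset:
  fixes u :: "'c \<Rightarrow>\<^sub>0 int"
  assumes "finite K" "Poly_Mapping.keys u \<subseteq> K" "\<And>c. c \<in> K \<Longrightarrow> h c \<in> carrier G"
  shows "finprod G (\<lambda>c. h c [^] Poly_Mapping.lookup u c) (Poly_Mapping.keys u) =
         finprod G (\<lambda>c. h c [^] Poly_Mapping.lookup u c) K"
proof (rule finprod_mono_neutral_cong_left[OF assms(1,2)])
  show "\<And>c. c \<in> K - Poly_Mapping.keys u \<Longrightarrow> h c [^] Poly_Mapping.lookup u c = \<one>"
    by (simp add: in_keys_iff)
qed (use assms(3) in auto)

text \<open>
  Additivity on the free abelian group, in the form without inverses that fits the recursion
  for semi-letters.
\<close>

lemma linear_extension_diff:
  fixes G (structure)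
  assumes "comm_group G"
    and "\<And>c. c \<in> Poly_Mapping.keys u \<union> Poly_Mapping.keys w \<Longrightarrow> the_elem (v ` c) \<in> carrier G"
  shows "linear_extension G v (u - w) \<otimes> linear_extension G v w = linear_extension G v u"
proof -
  interpret comm_group G by fact
  let ?K = "Poly_Mapping.keys u \<union> Poly_Mapping.keys w" and ?h = "\<lambda>c. the_elem (v ` c)"
  have h: "?h c \<in> carrier G" if "c \<in> ?K" for c using assms(2) that by blast
  have sub: "linear_extension G v x = finprod G (\<lambda>c. ?h c [^] Poly_Mapping.lookup x c) ?K"
    if "Poly_Mapping.keys x \<subseteq> ?K" for x
    unfolding linear_extension_def by (rule finprod_pow_superset) (use that h in auto)
  have "linear_extension G v (u - w) \<otimes> linear_extension G v w =
      finprod G (\<lambda>c. ?h c [^] Poly_Mapping.lookup (u - w) c \<otimes> ?h c [^] Poly_Mapping.lookup w c) ?K"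
    using h keys_diff[of u w] by (subst (1 2) sub) (auto simp: Pi_iff)
  also have "\<dots> = finprod G (\<lambda>c. ?h c [^] Poly_Mapping.lookup u c) ?K"
    by (rule finprod_cong') (use h in \<open>auto simp: int_pow_mult[symmetric] lookup_minus\<close>)
  also have "\<dots> = linear_extension G v u" by (rule sub[symmetric]) simp
  finally show ?thesis .
qed

lemma the_elem_homotopy_class:
  assumes "homotopy_invariant \<alpha> \<tau> S n G v" "nanophrase \<alpha> n p"
  shows "the_elem (v ` homotopy_class \<alpha> \<tau> S n p) = v p"
proof -
  have "v q = v p" if "homotopic \<alpha> \<tau> S n p q" for q
    using assms(1) that unfolding homotopy_invariant_def by metis
  then have "v ` homotopy_class \<alpha> \<tau> S n p = {v p}"
    using homotopic.refl[OF assms(2)] unfolding homotopy_class_def by blast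
  then show ?thesis by simp
qed

lemma linear_extension_frag_of:
  assumes "homotopy_invariant \<alpha> \<tau> S n G v" "nanophrase \<alpha> n p"
  shows "linear_extension G v (frag_of (homotopy_class \<alpha> \<tau> S n p)) = v p"
proof -
  interpret comm_group G using assms(1) by (simp add: homotopy_invariant_def)
  have "v p \<in> carrier G" using assms unfolding homotopy_invariant_def by blast
  then show ?thesis
    by (simp add: linear_extension_def the_elem_homotopy_class[OF assms])
qed

lemma concat_map_removeAll: "concat (map (removeAll A) ws) = removeAll A (concat ws)"
  by (induction ws) auto

lemma nanophrase_delete_letter:
  assumes "nanophrase \<alpha> n p"
  shows "nanophrase \<alpha> n (delete_letter A p)"
  using assms
  by (auto simp: nanophrase_def delete_letter_def letters_def concat_map_removeAll
      count_list_removeAll simp del: set_concat)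

lemma keys_semi_phrase:
  assumes "nanophrase \<alpha> n p"
  shows "Poly_Mapping.keys (semi_phrase \<alpha> \<tau> S n As p) \<subseteq>
         homotopy_class \<alpha> \<tau> S n ` Collect (nanophrase \<alpha> n)"
  using assms
proof (induction As arbitrary: p)
  case (Cons A As)
  from Cons.IH[OF Cons.prems] Cons.IH[OF nanophrase_delete_letter[OF Cons.prems, of A]]
  show ?case unfolding semi_phrase.simps by (blast dest: subsetD[OF keys_diff])
qed auto


section \<open>Values on phrases with semi-letters\<close>

text \<open>
  The part of the sum that survives when the letters in \<open>M\<close> are semi-letters.
\<close>

definition marked_sum ::
    "('a \<Rightarrow> 'a) \<Rightarrow> 'a \<Rightarrow> 'a \<Rightarrow> ('l \<Rightarrow> 'a) \<Rightarrow> ('l \<Rightarrow> bool) \<Rightarrow> 'l list \<Rightarrow> 'l set \<Rightarrow> int" where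
  "marked_sum \<tau> a b f c u M =
     (\<Sum>X\<in>set u. \<Sum>Y\<in>set u. if M \<subseteq> {X, Y} then pair_term \<tau> a b f c u X Y else 0)"

lemma marked_sum_empty [simp]: "marked_sum \<tau> a b f c u {} = pair_sum \<tau> a b f c u"
  by (simp add: marked_sum_def pair_sum_def)

text \<open>
  The terms that disappear with \<open>A\<close> are those of the pairs containing \<open>A\<close>. Each semi-letter
  thus restricts the sum to the pairs containing it.
\<close>

lemma marked_sum_insert:
  assumes "\<And>X. X \<noteq> A \<Longrightarrow> c' X = c X"
  shows "marked_sum \<tau> a b f c u (insert A M) + marked_sum \<tau> a b f c' (removeAll A u) M =
         marked_sum \<tau> a b f c u M"
proof -
  let ?g = "pair_term \<tau> a b f c u"
  let ?r = "\<lambda>X Y. if M \<subseteq> {X, Y} \<and> A \<notin> {X, Y} then ?g X Y else 0"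
  have "marked_sum \<tau> a b f c' (removeAll A u) M =
      (\<Sum>X\<in>set u - {A}. \<Sum>Y\<in>set u - {A}. ?r X Y)"
    unfolding marked_sum_def set_removeAll
  proof (rule sum.cong[OF HOL.refl], rule sum.cong[OF HOL.refl])
    fix X Y assume "X \<in> set u - {A}" "Y \<in> set u - {A}"
    then have ne: "X \<noteq> A" "Y \<noteq> A" by auto
    then have "pair_term \<tau> a b f c' (removeAll A u) X Y = ?g X Y"
      by (simp add: pair_term_def assms word_alternation_removeAll)
    then show "(if M \<subseteq> {X, Y} then pair_term \<tau> a b f c' (removeAll A u) X Y else 0) = ?r X Y"
      using ne by simp
  qed
  also have "\<dots> = (\<Sum>X\<in>set u - {A}. \<Sum>Y\<in>set u. ?r X Y)"
    by (rule sum.cong[OF HOL.refl], rule sum.mono_neutral_left) auto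
  also have "\<dots> = (\<Sum>X\<in>set u. \<Sum>Y\<in>set u. ?r X Y)"
    by (rule sum.mono_neutral_left) auto
  finally show ?thesis
    by (simp only: marked_sum_def sum.distrib[symmetric])
       (rule sum.cong[OF HOL.refl], rule sum.cong[OF HOL.refl], simp)
qed

lemma marked_sum_zero:
  assumes "card M > 2"
  shows "marked_sum \<tau> a b f c u M = 0"
proof -
  have "\<not> M \<subseteq> {X, Y}" for X Y
    using card_mono[of "{X, Y}" M] card_insert_le_m1[of 2 "{Y}" X] assms by auto
  then show ?thesis by (simp add: marked_sum_def)
qed

definition phrase_marked_sum ::
    "('a \<Rightarrow> 'a) \<Rightarrow> ('l, 'a) phrase \<Rightarrow> 'l set \<Rightarrow> nat \<Rightarrow> 'a \<times> 'a \<Rightarrow> int" where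
  "phrase_marked_sum \<tau> p M i ab =
     marked_sum \<tau> (fst ab) (snd ab) (snd p) (in_component (fst p) i) (concat (fst p)) M"

lemma phrase_marked_sum_insert:
  assumes "nanophrase \<alpha> n p" "i < n"
  shows "phrase_marked_sum \<tau> p (insert A M) i ab + phrase_marked_sum \<tau> (delete_letter A p) M i ab =
         phrase_marked_sum \<tau> p M i ab"
proof -
  have "in_component (map (removeAll A) (fst p)) i X = in_component (fst p) i X" if "X \<noteq> A" for X
    using assms that by (simp add: in_component_def nanophrase_def count_list_removeAll)
  then show ?thesis
    unfolding phrase_marked_sum_def delete_letter_def fst_conv snd_conv concat_map_removeAll
    by (rule marked_sum_insert)
qed

lemma T_invariant_eq_T_element:
  "T_invariant \<tau> \<alpha>\<^sub>o n p = T_element \<tau> \<alpha>\<^sub>o n (phrase_marked_sum \<tau> p {})"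
  unfolding T_invariant_def T_element_def
  by (auto intro!: restrict_ext simp: T_component_eq_pair_sum phrase_marked_sum_def)

lemma homotopy_invariant_T:
  assumes "involution_on \<alpha> \<tau>" "S = {(a, a, a) | a. a \<in> \<alpha>}" "\<alpha>\<^sub>o \<subseteq> \<alpha>"
  shows "homotopy_invariant \<alpha> \<tau> S n (T_codomain \<tau> \<alpha>\<^sub>o n)
           (T_invariant \<tau> \<alpha>\<^sub>o n :: ('l, 'a) phrase \<Rightarrow> _)"
  unfolding homotopy_invariant_def
proof (intro conjI allI impI)
  show "comm_group (T_codomain \<tau> \<alpha>\<^sub>o n)" by (rule comm_group_T_codomain)
  show "T_invariant \<tau> \<alpha>\<^sub>o n p \<in> carrier (T_codomain \<tau> \<alpha>\<^sub>o n)" for p :: "('l, 'a) phrase"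
    unfolding T_invariant_eq_T_element by (rule T_element_closed)
  show "T_invariant \<tau> \<alpha>\<^sub>o n p = T_invariant \<tau> \<alpha>\<^sub>o n q" if "homotopic \<alpha> \<tau> S n p q"
    for p q :: "('l, 'a) phrase"
  proof -
    have "T_component \<tau> i a b p = T_component \<tau> i a b q"
      if "i < n" "a \<in> \<alpha>\<^sub>o" "b \<in> \<alpha>\<^sub>o" for i a b
      using T_component_homotopic[OF assms(1,2) _ _ that(1) \<open>homotopic \<alpha> \<tau> S n p q\<close>]
        assms(3) that by blast
    then show ?thesis
      unfolding T_invariant_def by (auto intro!: restrict_ext)
  qed
qed

text \<open>
  Both sides satisfy the same recursion: removing a semi-letter \<open>A\<close> subtracts the value on the
  phrase without \<open>A\<close>, and this leaves the terms of the pairs containing \<open>A\<close>.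
\<close>

lemma linear_extension_semi_phrase:
  fixes p :: "('l, 'a) phrase"
  assumes inv: "homotopy_invariant \<alpha> \<tau> S n (T_codomain \<tau> \<alpha>\<^sub>o n)
                  (T_invariant \<tau> \<alpha>\<^sub>o n :: ('l, 'a) phrase \<Rightarrow> _)"
    and "nanophrase \<alpha> n p"
  shows "linear_extension (T_codomain \<tau> \<alpha>\<^sub>o n) (T_invariant \<tau> \<alpha>\<^sub>o n) (semi_phrase \<alpha> \<tau> S n As p) =
         T_element \<tau> \<alpha>\<^sub>o n (phrase_marked_sum \<tau> p (set As))"
  using assms(2)
proof (induction As arbitrary: p)
  case Nil
  have "linear_extension (T_codomain \<tau> \<alpha>\<^sub>o n) (T_invariant \<tau> \<alpha>\<^sub>o n)
      (frag_of (homotopy_class \<alpha> \<tau> S n p)) = T_invariant \<tau> \<alpha>\<^sub>o n p"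
    by (rule linear_extension_frag_of[OF inv Nil])
  also have "\<dots> = T_element \<tau> \<alpha>\<^sub>o n (phrase_marked_sum \<tau> p {})"
    by (rule T_invariant_eq_T_element)
  finally show ?case by simp
next
  case (Cons A As)
  let ?G = "T_codomain \<tau> \<alpha>\<^sub>o n" and ?T = "T_invariant \<tau> \<alpha>\<^sub>o n :: ('l, 'a) phrase \<Rightarrow> _"
  let ?d = "delete_letter A p"
  let ?u = "semi_phrase \<alpha> \<tau> S n As p" and ?w = "semi_phrase \<alpha> \<tau> S n As ?d"
  interpret comm_group ?G by (rule comm_group_T_codomain)
  note d = nanophrase_delete_letter[OF Cons.prems, of A]
  have carr: "the_elem (?T ` c) \<in> carrier ?G" if c: "c \<in> Poly_Mapping.keys ?u \<union> Poly_Mapping.keys ?w" for c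
  proof -
    obtain q where "nanophrase \<alpha> n q" "c = homotopy_class \<alpha> \<tau> S n q"
      using c keys_semi_phrase[OF Cons.prems, of \<tau> S As] keys_semi_phrase[OF d, of \<tau> S As]
      by blast
    then show ?thesis
      using the_elem_homotopy_class[OF inv] inv unfolding homotopy_invariant_def by metis
  qed
  have "T_element \<tau> \<alpha>\<^sub>o n (phrase_marked_sum \<tau> p (set As)) =
      T_element \<tau> \<alpha>\<^sub>o n (\<lambda>i ab. phrase_marked_sum \<tau> p (set (A # As)) i ab + phrase_marked_sum \<tau> ?d (set As) i ab)"
    unfolding T_element_def
    by (auto intro!: restrict_ext simp: phrase_marked_sum_insert[OF Cons.prems])
  also have "\<dots> = T_element \<tau> \<alpha>\<^sub>o n (phrase_marked_sum \<tau> p (set (A # As))) \<otimes>\<^bsub>?G\<^esub>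
      T_element \<tau> \<alpha>\<^sub>o n (phrase_marked_sum \<tau> ?d (set As))"
    by (rule T_element_add)
  finally have "linear_extension ?G ?T (?u - ?w) \<otimes>\<^bsub>?G\<^esub> T_element \<tau> \<alpha>\<^sub>o n (phrase_marked_sum \<tau> ?d (set As)) =
      T_element \<tau> \<alpha>\<^sub>o n (phrase_marked_sum \<tau> p (set (A # As))) \<otimes>\<^bsub>?G\<^esub>
      T_element \<tau> \<alpha>\<^sub>o n (phrase_marked_sum \<tau> ?d (set As))"
    using linear_extension_diff[OF comm_group_T_codomain carr, of ?u ?w]
    by (simp only: Cons.IH[OF Cons.prems] Cons.IH[OF d])
  moreover have "linear_extension ?G ?T (?u - ?w) \<in> carrier ?G"
    unfolding linear_extension_def
    by (rule finprod_closed) (use carr keys_diff[of ?u ?w] in blast)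
  ultimately show ?case
    unfolding semi_phrase.simps by (simp only: right_cancel T_element_closed)
qed


section \<open>The degree\<close>

lemma vanishes_above_T:
  assumes inv: "homotopy_invariant \<alpha> \<tau> S n (T_codomain \<tau> \<alpha>\<^sub>o n)
                  (T_invariant \<tau> \<alpha>\<^sub>o n :: ('l, 'a) phrase \<Rightarrow> _)"
  shows "vanishes_above \<alpha> \<tau> S n (T_codomain \<tau> \<alpha>\<^sub>o n) (T_invariant \<tau> \<alpha>\<^sub>o n :: ('l, 'a) phrase \<Rightarrow> _) 2"
  unfolding vanishes_above_def
proof (intro allI impI)
  fix p :: "('l, 'a) phrase" and As
  assume as: "nanophrase \<alpha> n p \<and> distinct As \<and> set As \<subseteq> letters p \<and> int (length As) > 2"
  then have "card (set As) > 2" by (simp add: distinct_card)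
  then have "phrase_marked_sum \<tau> p (set As) = (\<lambda>i ab. 0)"
    by (simp add: fun_eq_iff phrase_marked_sum_def marked_sum_zero)
  then show "linear_extension (T_codomain \<tau> \<alpha>\<^sub>o n) (T_invariant \<tau> \<alpha>\<^sub>o n) (semi_phrase \<alpha> \<tau> S n As p) =
      \<one>\<^bsub>T_codomain \<tau> \<alpha>\<^sub>o n\<^esub>"
    using linear_extension_semi_phrase[OF inv] as by (simp add: T_element_zero)
qed

text \<open>
  With \<open>A\<close> and \<open>B\<close> as semi-letters the terms of \<open>(A, B)\<close> and \<open>(B, A)\<close> remain. As the alternation is
  antisymmetric, they can cancel; the disjunction in the hypotheses is what makes the term of
  \<open>(B, A)\<close> zero.
\<close>

lemma degree_ge_2:
  assumes inv: "homotopy_invariant \<alpha> \<tau> S n (T_codomain \<tau> \<alpha>\<^sub>o n)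
                  (T_invariant \<tau> \<alpha>\<^sub>o n :: ('l, 'a) phrase \<Rightarrow> _)"
    and p: "nanophrase \<alpha> n p" "concat (fst p) = [A, B, A, B]" "A \<noteq> (B :: 'l)"
    and n: "n > 0" and ab: "snd p A \<in> \<alpha>\<^sub>o" "snd p B \<in> \<alpha>\<^sub>o"
    and A: "in_component (fst p) 0 A"
    and B: "\<not> in_component (fst p) 0 B \<or> snd p B \<notin> {snd p A, \<tau> (snd p A)}"
    and v: "vanishes_above \<alpha> \<tau> S n (T_codomain \<tau> \<alpha>\<^sub>o n) (T_invariant \<tau> \<alpha>\<^sub>o n :: ('l, 'a) phrase \<Rightarrow> _) k"
  shows "2 \<le> k"
proof (rule ccontr)
  assume "\<not> 2 \<le> k"
  then have "T_element \<tau> \<alpha>\<^sub>o n (phrase_marked_sum \<tau> p {A, B}) = \<one>\<^bsub>T_codomain \<tau> \<alpha>\<^sub>o n\<^esub>"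
    using v[unfolded vanishes_above_def, rule_format, of p "[A, B]"] p
      linear_extension_semi_phrase[OF inv p(1), of "[A, B]"]
    by (simp add: letters_def del: semi_phrase.simps set_concat)
  then have eq: "T_element \<tau> \<alpha>\<^sub>o n (phrase_marked_sum \<tau> p {A, B}) = T_element \<tau> \<alpha>\<^sub>o n (\<lambda>i ab. 0)"
    by (simp only: T_element_zero)
  let ?a = "snd p A" and ?b = "snd p B"
  from fun_cong[OF fun_cong[OF eq, of 0], of "(?a, ?b)"]
  have "T_reduce \<tau> ?a ?b (phrase_marked_sum \<tau> p {A, B} 0 (?a, ?b)) = T_reduce \<tau> ?a ?b 0"
    using n ab by (simp add: T_element_def)
  moreover have "phrase_marked_sum \<tau> p {A, B} 0 (?a, ?b) = 1"
  proof -
    have alt: "word_alternation [A, B, A, B] A B = 1" "word_alternation [A, B, A, B] B A = -1"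
      using p(3) by (simp_all add: word_alternation_def)
    have "label_sign \<tau> ?a ?b = 0" if "in_component (fst p) 0 B"
      using B that by (simp add: label_sign_def)
    then have "pair_term \<tau> ?a ?b (snd p) (in_component (fst p) 0) [A, B, A, B] B A = 0"
      by (simp add: pair_term_def)
    moreover have "pair_term \<tau> ?a ?b (snd p) (in_component (fst p) 0) [A, B, A, B] A B = 1"
      using A alt by (simp add: pair_term_def label_sign_def)
    moreover have "set [A, B, A, B] = {A, B}" by auto
    ultimately show ?thesis
      using p(3) by (simp add: phrase_marked_sum_def marked_sum_def p(2) del: list.set)
  qed
  ultimately show False by (simp add: T_reduce_def split: if_splits)
qed

lemma orientation_representative:
  assumes "orientation \<alpha> \<tau> \<alpha>\<^sub>o" "a \<in> \<alpha>"
  obtains c where "c \<in> \<alpha>\<^sub>o" "c \<in> {a, \<tau> a}"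
  using assms unfolding orientation_def by blast

lemma degree_ge_2_nondegenerate:
  assumes tau: "involution_on \<alpha> \<tau>" and ori: "orientation \<alpha> \<tau> \<alpha>\<^sub>o" and n: "n > 0"
    and nondeg: "T_nondegenerate \<alpha> \<tau> n"
    and inv: "homotopy_invariant \<alpha> \<tau> S n (T_codomain \<tau> \<alpha>\<^sub>o n)
                (T_invariant \<tau> \<alpha>\<^sub>o n :: ('l::infinite, 'a) phrase \<Rightarrow> _)"
    and v: "vanishes_above \<alpha> \<tau> S n (T_codomain \<tau> \<alpha>\<^sub>o n) (T_invariant \<tau> \<alpha>\<^sub>o n :: ('l, 'a) phrase \<Rightarrow> _) k"
  shows "2 \<le> k"
proof -
  obtain A B :: 'l where AB: "A \<noteq> B"
    using infinite_UNIV ex_new_if_finite[of "{undefined :: 'l}"] by auto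
  have sub: "\<alpha>\<^sub>o \<subseteq> \<alpha>" using ori by (simp add: orientation_def)
  show ?thesis
  proof (cases "n = 1")
    case True
    then obtain a b where ab: "a \<in> \<alpha>" "b \<in> \<alpha>" "b \<notin> {a, \<tau> a}"
      using nondeg by (auto simp: T_nondegenerate_def)
    obtain c where c: "c \<in> \<alpha>\<^sub>o" "c \<in> {a, \<tau> a}" by (rule orientation_representative[OF ori ab(1)])
    obtain d where d: "d \<in> \<alpha>\<^sub>o" "d \<in> {b, \<tau> b}" by (rule orientation_representative[OF ori ab(2)])
    have cd: "d \<notin> {c, \<tau> c}"
      using ab c(2) d(2) tau unfolding involution_on_def by (smt (verit) insert_iff singletonD)
    let ?p = "([[A, B, A, B]], \<lambda>X. if X = A then c else d)"
    show ?thesis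
    proof (rule degree_ge_2[OF inv _ _ AB n _ _ _ _ v, of ?p])
      show "nanophrase \<alpha> n ?p"
        using True AB c(1) d(1) sub by (auto simp: nanophrase_def letters_def)
    qed (use AB AB[symmetric] c(1) d(1) cd in \<open>simp_all add: in_component_def\<close>)
  next
    case False
    obtain c where c: "c \<in> \<alpha>\<^sub>o"
      using nondeg orientation_representative[OF ori] by (auto simp: T_nondegenerate_def)
    \<comment> \<open>with a second component at hand, equal labels suffice\<close>
    let ?p = "([A, B, A] # [B] # replicate (n - 2) [], \<lambda>X. c)"
    show ?thesis
    proof (rule degree_ge_2[OF inv _ _ AB n _ _ _ _ v, of ?p])
      show "nanophrase \<alpha> n ?p"
        using False n AB c sub by (auto simp: nanophrase_def letters_def)
    qed (use AB AB[symmetric] c in \<open>simp_all add: in_component_def\<close>)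
  qed
qed

theorem theorem7p2:
  fixes \<alpha> \<alpha>\<^sub>o :: "'a set" and \<tau> :: "'a \<Rightarrow> 'a" and S :: "('a \<times> 'a \<times> 'a) set" and n :: nat
    and T :: "('l::infinite, 'a) phrase \<Rightarrow> (nat \<Rightarrow> 'a \<times> 'a \<Rightarrow> int)"
  assumes "finite \<alpha>"
    and "involution_on \<alpha> \<tau>"
    and "S = {(a, a, a) | a. a \<in> \<alpha>}"
    and "n > 0"
    and "orientation \<alpha> \<tau> \<alpha>\<^sub>o"
    and "T = T_invariant \<tau> \<alpha>\<^sub>o n"
  shows "finite_type_invariant \<alpha> \<tau> S n (T_codomain \<tau> \<alpha>\<^sub>o n) T \<and>
         vanishes_above \<alpha> \<tau> S n (T_codomain \<tau> \<alpha>\<^sub>o n) T 2 \<and>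
         (T_nondegenerate \<alpha> \<tau> n \<longrightarrow> has_degree \<alpha> \<tau> S n (T_codomain \<tau> \<alpha>\<^sub>o n) T 2)"
proof -
  have "\<alpha>\<^sub>o \<subseteq> \<alpha>" using assms(5) by (simp add: orientation_def)
  then have inv: "homotopy_invariant \<alpha> \<tau> S n (T_codomain \<tau> \<alpha>\<^sub>o n) T"
    unfolding assms(6) using homotopy_invariant_T[OF assms(2,3)] by blast
  then have above: "vanishes_above \<alpha> \<tau> S n (T_codomain \<tau> \<alpha>\<^sub>o n) T 2"
    unfolding assms(6) by (rule vanishes_above_T)
  have "2 \<le> k" if "T_nondegenerate \<alpha> \<tau> n" "vanishes_above \<alpha> \<tau> S n (T_codomain \<tau> \<alpha>\<^sub>o n) T k" for k
    using degree_ge_2_nondegenerate[OF assms(2,5,4) that(1)] inv that(2) unfolding assms(6) by blast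
  then show ?thesis
    using inv above unfolding finite_type_invariant_def has_degree_def by blast
qed

end
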